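(* In the congested regime, where the feedback gains $k_s>0$ and $k_v>0$ are constant, the ACC-embedded traffic flow model $$\begin{bmatrix}\rho\\ v\end{bmatrix}_t+\begin{bmatrix} v & \rho\\ 0 & v-\dfrac{k_v}{\rho}\end{bmatrix}\begin{bmatrix}\rho\\ v\end{bmatrix}_x=\begin{bmatrix}0\\ \left(\dfrac1\rho-\tau v-L\right)k_s\end{bmatrix},\qquad \rho>0,$$ is strictly hyperbolic, i.e. at every state $(\rho,v)$ with $\rho>0$ in this regime the coefficient matrix multiplying the $x$-derivative has two real and distinct eigenvalues.
   Context: $\rho>0$ is traffic density (non-vacuum is assumed) and $v$ is speed. The constants $\tau$ and $L$ are the desired time headway and the standstill distance. The congested regime is the regime in which the adaptive cruise control (ACC) is active, so that the spacing gain and the speed-difference gain equal the positive constants $k_s$ and $k_v$. *)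

theory Defs
  imports Complex_Main "Jordan_Normal_Form.Char_Poly"
begin

text \<open>
  A first-order quasilinear system U_t + A(U) U_x = S(U) of n equations for an unknown
  U(t,x) with values in a set of admissible states in real n-space.
\<close>

record quasilinear_system =
  num_eqs :: nat
  states :: "real vec set"
  coeff_matrix :: "real vec \<Rightarrow> real mat"
  source_term :: "real vec \<Rightarrow> real vec"

text \<open>
  The eigenvalues counted are the real ones. An n x n matrix has at most n eigenvalues over
  the complex numbers, so n distinct real eigenvalues are all of its eigenvalues.
\<close>

definition strictly_hyperbolic_at :: "quasilinear_system \<Rightarrow> real vec \<Rightarrow> bool" where
  "strictly_hyperbolic_at Q U \<longleftrightarrow>
     coeff_matrix Q U \<in> carrier_mat (num_eqs Q) (num_eqs Q) \<and>
     card {\<mu> :: real. eigenvalue (coeff_matrix Q U) \<mu>} = num_eqs Q"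

definition strictly_hyperbolic :: "quasilinear_system \<Rightarrow> bool" where
  "strictly_hyperbolic Q \<longleftrightarrow> (\<forall>U \<in> states Q. strictly_hyperbolic_at Q U)"

text \<open>
  The state vector is (density, speed). The set C consists of the pairs (density, speed) of the
  congested regime, in which the gains have the constant values k_s (spacing) and
  k_v (speed difference); tau is the desired time headway and L the standstill distance.
\<close>

definition acc_traffic_model ::
  "(real \<times> real) set \<Rightarrow> real \<Rightarrow> real \<Rightarrow> real \<Rightarrow> real \<Rightarrow> quasilinear_system" where
  "acc_traffic_model C k\<^sub>s k\<^sub>v \<tau> L =
     \<lparr> num_eqs = 2,
       states = {vec_of_list [\<rho>, v] | \<rho> v. (\<rho>, v) \<in> C \<and> \<rho> > 0},
       coeff_matrix = (\<lambda>U. let \<rho> = U $ 0; v = U $ 1 in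
         mat_of_rows_list 2
           [[v, \<rho>],
            [0, v - k\<^sub>v / \<rho>]]),
       source_term = (\<lambda>U. let \<rho> = U $ 0; v = U $ 1 in
         vec_of_list [0, (1 / \<rho> - \<tau> * v - L) * k\<^sub>s]) \<rparr>"

end

theory Submission
  imports Defs
begin

text \<open>The coefficient matrix is upper triangular, so by
  \<open>eigenvalues_upper_triangular\<close> its eigenvalues are the diagonal entries
  \<open>v\<close> and \<open>v - k\<^sub>v / \<rho>\<close>. Both are real, and their gap
  \<open>k\<^sub>v / \<rho>\<close> is positive.\<close>

text \<open>The characteristic polynomial is the product of the factors X - a over the diagonal
  entries a, and in a field a product vanishes only where some factor does.\<close>

lemma eigenvalues_upper_triangular:
  fixes A :: "'a :: field mat"
  assumes "A \<in> carrier_mat n n" and "upper_triangular A"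
  shows "{\<mu>. eigenvalue A \<mu>} = set (diag_mat A)"
  by (auto simp: eigenvalue_root_char_poly[OF assms(1)]
      char_poly_upper_triangular[OF assms] poly_prod_list prod_list_zero_iff)

theorem lemma1:
  fixes k\<^sub>s k\<^sub>v \<tau> L :: real and C :: "(real \<times> real) set"
  assumes "k\<^sub>s > 0" and "k\<^sub>v > 0"
  shows "strictly_hyperbolic (acc_traffic_model C k\<^sub>s k\<^sub>v \<tau> L)"
  unfolding strictly_hyperbolic_def
proof
  let ?Q = "acc_traffic_model C k\<^sub>s k\<^sub>v \<tau> L"
  fix U assume "U \<in> states ?Q"
  then obtain \<rho> v where U: "U = vec_of_list [\<rho>, v]" and \<rho>: "\<rho> > 0"
    by (auto simp: acc_traffic_model_def)
  define A where "A = mat_of_rows_list 2 [[v, \<rho>], [0, v - k\<^sub>v / \<rho>]]"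
  have coeff: "coeff_matrix ?Q U = A"
    by (simp add: acc_traffic_model_def U A_def)
  have A: "A \<in> carrier_mat 2 2"
    by (simp add: A_def mat_of_rows_list_def numeral_2_eq_2)
  have "upper_triangular A"
    by (auto simp: A_def mat_of_rows_list_def upper_triangular_def less_Suc_eq numeral_2_eq_2)
  then have "{\<mu>. eigenvalue A \<mu>} = set (diag_mat A)"
    by (rule eigenvalues_upper_triangular[OF A])
  also have "\<dots> = {v, v - k\<^sub>v / \<rho>}"
    by (simp add: A_def mat_of_rows_list_def diag_mat_def numeral_2_eq_2)
  \<comment> \<open>The two listed elements differ because \<open>k\<^sub>v / \<rho>\<close> is
    nonzero.\<close>
  finally have "card {\<mu>. eigenvalue A \<mu>} = 2"
    using assms(2) \<rho> by simp
  then show "strictly_hyperbolic_at ?Q U"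
    \<comment> \<open>The model stays folded at first so that \<open>coeff\<close> can rewrite its
      matrix to \<open>A\<close>; unfolding it afterwards gives the number of equations, 2.\<close>
    using A by (simp add: strictly_hyperbolic_at_def coeff) (simp add: acc_traffic_model_def)
qed

end
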